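(* Let $\tau \neq 0$ be real, let $n\ge 1$ be an integer, and suppose that $V,W:\mathbb{R}\to\mathbb{R}$ are (measurable) functions for which the integrals $$\int_{-\infty}^{\infty}\int_{-\infty}^{\infty} x^k y^j e^{-n(V(x)+W(y)-\tau xy)}\,dx\,dy,\qquad k=0,1,2,\ldots,\quad j=0,1,2,\ldots,$$ converge. Let $(p_{k,n})_{k=0}^\infty$ and $(q_{k,n})_{k=0}^\infty$ be the two sequences of monic polynomials with $\deg p_{k,n}=\deg q_{k,n}=k$ satisfying $$\int_{-\infty}^{\infty}\int_{-\infty}^{\infty} p_{k,n}(x)q_{j,n}(y)e^{-n(V(x)+W(y)-\tau xy)}\,dx\,dy=0,\qquad k\neq j.$$ Then the following hold for every $k=1,2,\ldots$: (a) The zeros of $p_{k,n}$ and $p_{k+1,n}$ interlace, and similarly the zeros of $q_{k,n}$ and $q_{k+1,n}$ interlace. (b) If $V$ and $W$ are even, then the positive zeros of $p_{k,n}$ and $p_{k+2,n}$ interlace, and similarly the positive zeros of $q_{k,n}$ and $q_{k+2,n}$ interlace.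
   Context: Under the stated integrability hypothesis it is a known result (Ercolani–McLaughlin) that the two sequences of monic biorthogonal polynomials exist, are unique, and have only real and simple zeros. Two ordered sequences of real numbers $\alpha_1,\ldots,\alpha_m$ and $\beta_1,\ldots,\beta_{m+1}$ are said to interlace if $\beta_1<\alpha_1<\beta_2<\alpha_2<\cdots<\alpha_{m-1}<\beta_m<\alpha_m<\beta_{m+1}$ (the zeros of the polynomial of lower degree play the role of the $\alpha$'s and those of the polynomial of higher degree the role of the $\beta$'s; for $m=0$ the condition is void). *)

theory Defs
  imports "HOL-Analysis.Analysis" "HOL-Computational_Algebra.Computational_Algebra"
begin

definition tm_weight :: "nat \<Rightarrow> real \<Rightarrow> (real \<Rightarrow> real) \<Rightarrow> (real \<Rightarrow> real) \<Rightarrow> real \<Rightarrow> real \<Rightarrow> real" where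
  "tm_weight n \<tau> V W x y = exp (- real n * (V x + W y - \<tau> * x * y))"

text \<open>Double integrals are Lebesgue integrals over the plane. For the moments, convergence of the
  double integrals with even exponents already implies absolute convergence for all exponents.\<close>

definition moments_converge ::
    "nat \<Rightarrow> real \<Rightarrow> (real \<Rightarrow> real) \<Rightarrow> (real \<Rightarrow> real) \<Rightarrow> bool" where
  "moments_converge n \<tau> V W \<longleftrightarrow>
     (\<forall>k j. integrable lebesgue (\<lambda>(x, y). x ^ k * y ^ j * tm_weight n \<tau> V W x y))"

definition monic_biorthogonal ::
    "nat \<Rightarrow> real \<Rightarrow> (real \<Rightarrow> real) \<Rightarrow> (real \<Rightarrow> real) \<Rightarrow>
     (nat \<Rightarrow> real poly) \<Rightarrow> (nat \<Rightarrow> real poly) \<Rightarrow> bool" where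
  "monic_biorthogonal n \<tau> V W p q \<longleftrightarrow>
     (\<forall>k. lead_coeff (p k) = 1 \<and> degree (p k) = k) \<and>
     (\<forall>k. lead_coeff (q k) = 1 \<and> degree (q k) = k) \<and>
     (\<forall>k j. k \<noteq> j \<longrightarrow>
        (LINT (x, y)|lebesgue. poly (p k) x * poly (q j) y * tm_weight n \<tau> V W x y) = 0)"

text \<open>The first list is the shorter one. The inequalities force both lists to be strictly
  increasing; when the first list is empty, only the length condition remains.\<close>

definition interlace :: "real list \<Rightarrow> real list \<Rightarrow> bool" where
  "interlace \<alpha> \<beta> \<longleftrightarrow> length \<beta> = length \<alpha> + 1 \<and>
     (\<forall>i<length \<alpha>. \<beta> ! i < \<alpha> ! i \<and> \<alpha> ! i < \<beta> ! (i + 1))"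

text \<open>Zeros are taken in the complex plane and with multiplicity. Interlacing of zeros therefore
  says in particular that they are all real and simple.\<close>

definition zeros :: "real poly \<Rightarrow> complex multiset" where
  "zeros f = proots (map_poly complex_of_real f)"

definition positive_zeros :: "real poly \<Rightarrow> complex multiset" where
  "positive_zeros f = filter_mset (\<lambda>z. z \<in> \<real> \<and> 0 < Re z) (zeros f)"

definition zeros_interlace :: "complex multiset \<Rightarrow> complex multiset \<Rightarrow> bool" where
  "zeros_interlace A B \<longleftrightarrow> (\<exists>\<alpha> \<beta>. A = mset (map complex_of_real \<alpha>) \<and>
     B = mset (map complex_of_real \<beta>) \<and> interlace \<alpha> \<beta>)"

end

theory Submission
  imports Defs
begin

text \<open>The weight factorises as \<open>u x * v y * exp (c * x * y)\<close> with positive \<open>u\<close>, \<open>v\<close> and \<open>c = n \<tau> \<noteq> 0\<close>, and the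
  theorem is a consequence of the variation diminishing property of the kernel \<open>exp (c * x * y)\<close>.

  The key fact is \<open>card_odd_roots_ge\<close>: a nonzero polynomial \<open>f\<close> whose pairing with every polynomial of degree
  below \<open>k\<close> vanishes changes sign at \<open>k\<close> or more real points. Suppose that it has only \<open>m < k\<close> sign changes
  and put \<open>F y = \<integral> f x * u x * exp (c * x * y) dx\<close>. This continuous function has at most \<open>m\<close> real zeros: if it
  vanished at \<open>m + 1\<close> points \<open>t\<close>, choose coefficients such that \<open>E x = (\<Sum>t. a t * exp (c * t * x))\<close> has
  precisely the sign changes of \<open>f\<close> (\<open>exp_sum_prescribed_sign_changes\<close>). Then \<open>f * u * E\<close> has one sign, but its
  integral is \<open>\<Sum>t. a t * F t = 0\<close>. Hence a polynomial \<open>Q\<close> of degree at most \<open>m\<close> has the sign changes of \<open>F\<close>. The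
  pairing of \<open>f\<close> and \<open>Q\<close> is \<open>\<integral> F y * Q y * v y dy\<close>. Its integrand has one sign, so it is not zero, although
  \<open>Q\<close> has degree below \<open>k\<close>.

  For \<open>f = p k\<close> this shows that all zeros are real and simple. It is also applied to nontrivial combinations
  \<open>f = a p k + b p l\<close> with \<open>k < l\<close>. Such a combination has degree at most \<open>l\<close> and at least \<open>k\<close> roots of odd order, and every
  multiple real root uses up two further degrees (\<open>combination_multiple_roots\<close>). For \<open>l = k + 1\<close> there is no
  multiple real root, which means that the Wronskian of \<open>p k\<close> and \<open>p (k + 1)\<close> has no real zero. By Sturm's
  separation argument (\<open>interlace_of_wronskian\<close>) the zeros interlace. If \<open>V\<close> and \<open>W\<close> are even, then
  \<open>p k\<close> has the parity of \<open>k\<close>, so multiple roots of a combination of \<open>p k\<close> and \<open>p (k + 2)\<close> away from the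
  origin come in pairs; but there is room for only one. Thus the Wronskian does not vanish on the
  positive half-line, and the same separation argument interlaces the positive zeros.

  The statements about \<open>q\<close> follow by exchanging the two variables.\<close>

section \<open>Exponential sums with prescribed sign changes\<close>

lemma Rolle_finite_set:
  fixes f f' :: "real \<Rightarrow> real"
  assumes "finite A" and deriv: "\<And>x. (f has_real_derivative f' x) (at x)"
    and "\<And>x. x \<in> A \<Longrightarrow> f x = 0"
  obtains B where "finite B" "card A \<le> card B + 1" "A \<inter> B = {}" "\<And>x. x \<in> B \<Longrightarrow> f' x = 0"
proof -
  have "\<exists>B. finite B \<and> card A \<le> card B + 1 \<and> A \<inter> B = {} \<and> (\<forall>x\<in>B. f' x = 0 \<and> (\<exists>a\<in>A. x < a))"
    using assms(1,3)
  proof (induction A rule: finite_linorder_max_induct)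
    case empty
    then show ?case by (intro exI[of _ "{}"]) auto
  next
    case (insert b A)
    show ?case
    proof (cases "A = {}")
      case True
      then show ?thesis by (intro exI[of _ "{}"]) auto
    next
      case False
      obtain B where B: "finite B" "card A \<le> card B + 1" "A \<inter> B = {}"
          "\<forall>x\<in>B. f' x = 0 \<and> (\<exists>a\<in>A. x < a)"
        using insert.IH insert.prems by auto
      let ?a = "Max A"
      have a: "?a \<in> A" "?a < b" "\<And>x. x \<in> A \<Longrightarrow> x \<le> ?a"
        using insert.hyps False by auto
      have "\<exists>z. ?a < z \<and> z < b \<and> DERIV f z :> 0"
      proof (rule Rolle)
        show "f ?a = f b" using insert.prems a by auto
        show "continuous_on {?a..b} f"
          using deriv by (meson DERIV_isCont continuous_at_imp_continuous_on)
        show "\<And>x. ?a < x \<Longrightarrow> x < b \<Longrightarrow> f differentiable (at x)"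
          using deriv real_differentiable_def by blast
      qed (use a in auto)
      then obtain z where z: "?a < z" "z < b" "DERIV f z :> 0" by auto
      then have "f' z = 0" using deriv DERIV_unique by blast
      moreover have "z \<notin> B" "b \<notin> B" "z \<notin> A"
        using B(4) a z insert.hyps by (meson less_le_not_le order_less_trans less_asym)+
      moreover have "b \<notin> A" using insert.hyps by auto
      ultimately show ?thesis
        using B z insert.hyps by (intro exI[of _ "insert z B"]) auto
    qed
  qed
  then show thesis using that by blast
qed

definition exp_sum :: "real \<Rightarrow> (real \<Rightarrow> real) \<Rightarrow> real set \<Rightarrow> real \<Rightarrow> real" where
  "exp_sum c a T x = (\<Sum>t\<in>T. a t * exp (c * t * x))"

lemma exp_sum_deriv:
  "(exp_sum c a T has_real_derivative exp_sum c (\<lambda>t. a t * (c * t)) T x) (at x)"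
  unfolding exp_sum_def by (auto intro!: derivative_eq_intros sum.cong)

lemma exp_sum_divide_deriv:
  assumes "finite T" "t0 \<notin> T"
  shows "((\<lambda>x. exp (- (c * t0 * x)) * exp_sum c a (insert t0 T) x) has_real_derivative
     exp (- (c * t0 * x)) * exp_sum c (\<lambda>t. a t * (c * (t - t0))) T x) (at x)"
proof -
  let ?E = "exp_sum c a (insert t0 T)" and ?E' = "exp_sum c (\<lambda>t. a t * (c * t)) (insert t0 T)"
  have "?E' x - c * t0 * ?E x = exp_sum c (\<lambda>t. a t * (c * (t - t0))) T x"
    using assms unfolding exp_sum_def
    by (simp add: sum_distrib_left algebra_simps flip: sum_subtractf)
  moreover have "((\<lambda>x. exp (- (c * t0 * x)) * ?E x) has_real_derivative
     exp (- (c * t0 * x)) * (?E' x - c * t0 * ?E x)) (at x)"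
    by (auto intro!: derivative_eq_intros exp_sum_deriv simp: algebra_simps)
  ultimately show ?thesis by simp
qed

text \<open>Exponential sums behave like polynomials with one term per frequency. The argument is the one
  behind Descartes' rule: dividing by one of the exponentials and differentiating removes that term,
  and by Rolle it removes at most one zero.\<close>

lemma card_exp_sum_zeros:
  assumes "finite T" "c \<noteq> 0" "\<exists>t\<in>T. a t \<noteq> 0"
    and "finite A" "\<And>x. x \<in> A \<Longrightarrow> exp_sum c a T x = 0"
  shows "card A < card T"
  using assms
proof (induction T arbitrary: a A)
  case (insert t0 T)
  show ?case
  proof (cases "\<forall>t\<in>T. a t = 0")
    case True
    then have "exp_sum c a (insert t0 T) x = a t0 * exp (c * t0 * x)" for x
      using insert.hyps by (simp add: exp_sum_def)
    then have "A = {}" using True insert.prems by auto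
    then show ?thesis using insert.hyps by (simp add: card_gt_0_iff)
  next
    case False
    let ?b = "\<lambda>t. a t * (c * (t - t0))"
    obtain B where B: "finite B" "card A \<le> card B + 1"
        "\<And>x. x \<in> B \<Longrightarrow> exp (- (c * t0 * x)) * exp_sum c ?b T x = 0"
    proof (rule Rolle_finite_set[OF \<open>finite A\<close> exp_sum_divide_deriv[OF insert.hyps, of c a]])
      show "exp (- (c * t0 * x)) * exp_sum c a (insert t0 T) x = 0" if "x \<in> A" for x
        using insert.prems that by simp
    qed blast
    have "card B < card T"
    proof (rule insert.IH)
      show "\<exists>t\<in>T. ?b t \<noteq> 0" using False insert.hyps \<open>c \<noteq> 0\<close> by auto
    qed (use B insert.prems in auto)
    then show ?thesis using B insert.hyps by simp
  qed
qed auto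

text \<open>When the maximal number of zeros is attained, none of them can be multiple: a multiple zero would
  survive the differentiation in addition to the zeros that Rolle puts strictly between the others, and
  the shortened sum would have too many zeros.\<close>

lemma exp_sum_zeros_simple:
  assumes "finite T" "c \<noteq> 0" "\<exists>t\<in>T. a t \<noteq> 0"
    and "finite A" "\<And>x. x \<in> A \<Longrightarrow> exp_sum c a T x = 0"
    and card: "card T = card A + 1" and "s \<in> A"
  shows "exp_sum c (\<lambda>t. a t * (c * t)) T s \<noteq> 0"
proof
  assume deriv0: "exp_sum c (\<lambda>t. a t * (c * t)) T s = 0"
  obtain t1 where t1: "t1 \<in> T" "a t1 \<noteq> 0" using assms by auto
  have "card T \<noteq> 1" using card assms by (auto simp: card_gt_0_iff)
  then have "T \<noteq> {t1}" by auto
  then obtain t0 where t0: "t0 \<in> T" "t0 \<noteq> t1" using t1 by blast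
  define T' where "T' = T - {t0}"
  have T: "T = insert t0 T'" "t0 \<notin> T'" "finite T'" "t1 \<in> T'"
    using t0 t1 assms by (auto simp: T'_def)
  let ?b = "\<lambda>t. a t * (c * (t - t0))"
  have D: "((\<lambda>x. exp (- (c * t0 * x)) * exp_sum c a T x) has_real_derivative
      exp (- (c * t0 * x)) * exp_sum c ?b T' x) (at x)" for x
    using exp_sum_divide_deriv[OF T(3,2)] T by simp
  obtain B where B: "finite B" "card A \<le> card B + 1" "A \<inter> B = {}"
      "\<And>x. x \<in> B \<Longrightarrow> exp (- (c * t0 * x)) * exp_sum c ?b T' x = 0"
  proof (rule Rolle_finite_set[OF \<open>finite A\<close> D])
    show "exp (- (c * t0 * x)) * exp_sum c a T x = 0" if "x \<in> A" for x
      using assms(5)[OF that] by simp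
  qed blast
  have "((\<lambda>x. exp (- (c * t0 * x)) * exp_sum c a T x) has_real_derivative 0) (at s)"
    using deriv0 assms(5,7)
    by (auto intro!: derivative_eq_intros exp_sum_deriv)
  then have "exp_sum c ?b T' s = 0" using D[of s] DERIV_unique by fastforce
  then have "card (insert s B) < card T'"
    using B T t1 t0 \<open>c \<noteq> 0\<close> by (intro card_exp_sum_zeros[of T' c ?b]) auto
  moreover have "s \<notin> B" using B assms by auto
  moreover have "card T = card T' + 1" using T by simp
  ultimately show False using B card by simp
qed

text \<open>The set \<open>S\<close> collects the points where \<open>F\<close> changes sign. The third assumption is weaker than continuity
  because the induction on the largest point \<open>b\<close> of \<open>Z\<close> replaces \<open>F\<close> to the right of \<open>b\<close> by a constant:
  that erases \<open>b\<close> from the exceptional set, but may create a jump.\<close>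

lemma sign_pattern:
  fixes F :: "real \<Rightarrow> real"
  assumes "finite Z" "\<And>y. y \<notin> Z \<Longrightarrow> F y \<noteq> 0"
    and "\<And>a b. a < b \<Longrightarrow> {a..b} \<inter> Z = {} \<Longrightarrow> 0 < F a * F b"
  shows "\<exists>S\<subseteq>Z. \<exists>\<sigma>\<in>{1,-1}. \<forall>y. y \<notin> Z \<longrightarrow> 0 < \<sigma> * F y * (\<Prod>z\<in>S. y - z)"
  using assms
proof (induction Z arbitrary: F rule: finite_linorder_max_induct)
  case empty
  have "0 < F 0 * F y" for y
    using empty.prems(2)[of 0 y] empty.prems(2)[of y 0] empty.prems(1)[of 0]
    by (cases y "0::real" rule: linorder_cases) (auto simp: mult.commute zero_less_mult_iff neq_iff)
  then have "(\<forall>y. 0 < F y) \<or> (\<forall>y. F y < 0)"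
    by (metis zero_less_mult_iff not_less_iff_gr_or_eq)
  then show ?case by auto
next
  case (insert b A)
  obtain c where c: "c < b" "\<And>a. a \<in> A \<Longrightarrow> a < c"
  proof (cases "A = {}")
    case True
    then show thesis using that[of "b - 1"] by auto
  next
    case False
    then have "Max A < b" "\<And>a. a \<in> A \<Longrightarrow> a \<le> Max A" using insert.hyps by auto
    then show thesis using that dense[of "Max A" b] by (meson order.strict_trans1)
  qed
  have Fc: "F c \<noteq> 0" using c insert.prems(1)[of c] by fastforce
  have near: "0 < F u * F v" if "u \<notin> insert b A" "v \<notin> insert b A" "{min u v..max u v} \<inter> insert b A = {}" for u v
    using insert.prems(2)[of u v] insert.prems(2)[of v u] insert.prems(1)[OF that(1)] that(3)
    by (cases u v rule: linorder_cases) (auto simp: mult.commute zero_less_mult_iff neq_iff)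
  have left: "0 < F u * F c" if "u < b" "{u..<b} \<inter> A = {}" for u
    by (rule near) (use that c in \<open>force simp: min_def max_def disjoint_iff\<close>)+
  \<comment> \<open>the point \<open>c\<close> lies to the right of every other exceptional point, so \<open>F c\<close> carries the sign of \<open>F\<close> just left of \<open>b\<close>\<close>
  define F' where "F' y = (if y < b then F y else F c)" for y
  have "\<exists>S\<subseteq>A. \<exists>\<sigma>\<in>{1,-1}. \<forall>y. y \<notin> A \<longrightarrow> 0 < \<sigma> * F' y * (\<Prod>z\<in>S. y - z)"
  proof (rule insert.IH)
    fix y assume "y \<notin> A"
    then show "F' y \<noteq> 0" using insert.prems(1)[of y] Fc by (auto simp: F'_def)
  next
    fix u v :: real assume uv: "u < v" "{u..v} \<inter> A = {}"
    consider "v < b" | "u < b" "b \<le> v" | "b \<le> u" by linarith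
    then show "0 < F' u * F' v"
    proof cases
      case 1
      then have "{u..v} \<inter> insert b A = {}" using uv by auto
      then show ?thesis using insert.prems(2)[OF uv(1)] uv 1 by (auto simp: F'_def)
    next
      case 2
      then have "{u..<b} \<inter> A = {}" using uv by force
      then show ?thesis using left[of u] 2 by (auto simp: F'_def)
    next
      case 3
      then show ?thesis using Fc uv by (auto simp: F'_def zero_less_mult_iff neq_iff)
    qed
  qed
  then obtain S \<sigma> where S: "S \<subseteq> A" and \<sigma>: "\<sigma> = 1 \<or> \<sigma> = -1"
    and pos: "\<And>y. y \<notin> A \<Longrightarrow> 0 < \<sigma> * F' y * (\<Prod>z\<in>S. y - z)" by blast
  have notA: "y \<notin> A" if "b < y" for y using that insert.hyps(2) by force
  have right: "0 < F y * F (b + 1)" if "b < y" for y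
    by (rule near) (use that notA in \<open>auto simp: min_def max_def disjoint_iff split: if_splits\<close>)
  have low: "0 < \<sigma> * F y * (\<Prod>z\<in>S. y - z)" if "y < b" "y \<notin> A" for y
    using pos[OF that(2)] that by (simp add: F'_def)
  have high: "0 < \<sigma> * F c * (\<Prod>z\<in>S. y - z)" if "b < y" for y
    using pos[OF notA[OF that]] that by (simp add: F'_def)
  have Fb: "F (b + 1) \<noteq> 0" using insert.prems(1) notA[of "b+1"] by auto
  show ?case
  proof (cases "0 < F c * F (b + 1)")
    case True
    have "0 < \<sigma> * F y * (\<Prod>z\<in>S. y - z)" if "y \<notin> insert b A" for y
    proof (cases "y < b")
      case False
      then have "b < y" using that by auto
      then show ?thesis
        using high[of y] right[of y] True \<sigma> by (auto simp: zero_less_mult_iff)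
    qed (use low that in auto)
    then show ?thesis using S \<sigma> by blast
  next
    case False
    then have opp: "F c * F (b + 1) < 0" using Fc Fb
      by (metis linorder_neqE_linordered_idom mult_eq_0_iff)
    have fin: "finite S" "b \<notin> S" using S insert.hyps finite_subset by blast+
    have "0 < - \<sigma> * F y * (\<Prod>z\<in>insert b S. y - z)" if "y \<notin> insert b A" for y
    proof (cases "y < b")
      case True
      have "- \<sigma> * F y * (\<Prod>z\<in>insert b S. y - z) = (b - y) * (\<sigma> * F y * (\<Prod>z\<in>S. y - z))"
        using fin by (simp add: algebra_simps)
      then show ?thesis using low[of y] True that by simp
    next
      case False
      then have y: "b < y" using that by auto
      then have "0 < - \<sigma> * F y * (\<Prod>z\<in>S. y - z)"
        using high[of y] right[of y] opp \<sigma> by (auto simp: zero_less_mult_iff mult_less_0_iff)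
      then have "0 < (y - b) * (- \<sigma> * F y * (\<Prod>z\<in>S. y - z))"
        by (rule mult_pos_pos[rotated]) (use y in simp)
      then show ?thesis using fin by (simp add: algebra_simps)
    qed
    moreover have "insert b S \<subseteq> insert b A" "- \<sigma> \<in> {1, -1}" using S \<sigma> by auto
    ultimately show ?thesis by blast
  qed
qed

lemma continuous_same_sign:
  fixes F :: "real \<Rightarrow> real"
  assumes "a \<le> b" "continuous_on {a..b} F" "\<And>y. y \<in> {a..b} \<Longrightarrow> F y \<noteq> 0"
  shows "0 < F a * F b"
proof (rule ccontr)
  assume "\<not> ?thesis"
  then have "(F a \<le> 0 \<and> 0 \<le> F b) \<or> (F b \<le> 0 \<and> 0 \<le> F a)"
    by (auto simp: zero_less_mult_iff not_less not_le)
  then obtain x where "a \<le> x" "x \<le> b" "F x = 0"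
    using IVT'[of F a 0 b] IVT2'[of F b 0 a] assms(1,2) by auto
  then show False using assms(3)[of x] by simp
qed

lemma continuous_sign_pattern:
  fixes F :: "real \<Rightarrow> real"
  assumes "finite Z" "\<And>y. y \<notin> Z \<Longrightarrow> F y \<noteq> 0" "\<And>a b. continuous_on {a..b} F"
  obtains S \<sigma> where "S \<subseteq> Z" "\<sigma> = 1 \<or> \<sigma> = -1"
    "\<And>y. y \<notin> Z \<Longrightarrow> 0 < \<sigma> * F y * (\<Prod>z\<in>S. y - z)"
proof -
  have "0 < F a * F b" if "a < b" "{a..b} \<inter> Z = {}" for a b
    using continuous_same_sign[of a b F] that assms by (meson disjoint_iff less_imp_le)
  from sign_pattern[of Z F, OF assms(1,2) this] obtain S \<sigma>
    where "S \<subseteq> Z" "\<sigma> \<in> {1, -1}" "\<forall>y. y \<notin> Z \<longrightarrow> 0 < \<sigma> * F y * (\<Prod>z\<in>S. y - z)"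
    by blast
  then show thesis by (intro that[of S \<sigma>]) auto
qed

text \<open>Gaussian elimination of one equation and one unknown at a time: a homogeneous linear system with
  more unknowns (indexed by \<open>T\<close>) than equations (indexed by \<open>S\<close>) has a nontrivial solution.\<close>

lemma underdetermined_system_solution:
  fixes K :: "'a \<Rightarrow> 'b \<Rightarrow> 'c::field"
  assumes "finite S" "finite T" "card S < card T"
  shows "\<exists>a. (\<exists>t\<in>T. a t \<noteq> 0) \<and> (\<forall>s\<in>S. (\<Sum>t\<in>T. a t * K t s) = 0)"
  using assms
proof (induction S arbitrary: T K)
  case empty
  then have "T \<noteq> {}" by auto
  then show ?case by (intro exI[of _ "\<lambda>_. 1"]) auto
next
  case (insert s S)
  show ?case
  proof (cases "\<forall>t\<in>T. K t s = 0")
    case True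
    have "card S < card T" using insert.prems insert.hyps by simp
    then obtain a where "\<exists>t\<in>T. a t \<noteq> 0" "\<forall>s\<in>S. (\<Sum>t\<in>T. a t * K t s) = 0"
      using insert.IH[of T K] insert.prems by auto
    then show ?thesis using True by (intro exI[of _ a]) auto
  next
    case False
    then obtain t0 where t0: "t0 \<in> T" "K t0 s \<noteq> 0" by auto
    define T' where "T' = T - {t0}"
    have T: "T = insert t0 T'" "t0 \<notin> T'" "finite T'" using t0 insert.prems by (auto simp: T'_def)
    define L where "L t r = K t r - K t s / K t0 s * K t0 r" for t r
    have "card S < card T'" using insert.prems insert.hyps T by simp
    then obtain a where a: "\<exists>t\<in>T'. a t \<noteq> 0" "\<forall>r\<in>S. (\<Sum>t\<in>T'. a t * L t r) = 0"
      using insert.IH[of T' L] T by auto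
    define a0 where "a0 = - (\<Sum>t\<in>T'. a t * (K t s / K t0 s))"
    define b where "b = a(t0 := a0)"
    have b: "(\<Sum>t\<in>T. b t * K t r) = (\<Sum>t\<in>T'. a t * L t r)" for r
    proof -
      have "(\<Sum>t\<in>T. b t * K t r) = a0 * K t0 r + (\<Sum>t\<in>T'. a t * K t r)"
        using T by (auto simp: b_def intro!: sum.cong)
      also have "\<dots> = (\<Sum>t\<in>T'. a t * L t r)"
        by (simp add: a0_def L_def sum_distrib_left sum_distrib_right algebra_simps sum_subtractf sum_negf)
      finally show ?thesis .
    qed
    have "\<exists>t\<in>T. b t \<noteq> 0" using a(1) T by (auto simp: b_def)
    moreover have "(\<Sum>t\<in>T. b t * K t s) = 0" unfolding b L_def using t0 by simp
    ultimately show ?thesis using a(2) b by (intro exI[of _ b]) auto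
  qed
qed

text \<open>This is what total positivity of the kernel \<open>exp (c * t * x)\<close> is needed for. Linear algebra makes
  the sum vanish on \<open>S\<close>; the zero count says that it vanishes nowhere else, and simplicity of the zeros
  forces a sign change at each of them. Indeed, a zero without a sign change would be a local
  extremum, and the derivative would vanish there.\<close>

lemma exp_sum_prescribed_sign_changes:
  assumes "finite S" "finite T" "card T = card S + 1" "c \<noteq> 0"
  obtains a where "\<And>x. x \<notin> S \<Longrightarrow> 0 < exp_sum c a T x * (\<Prod>s\<in>S. x - s)"
proof -
  obtain a where a: "\<exists>t\<in>T. a t \<noteq> 0" "\<And>s. s \<in> S \<Longrightarrow> exp_sum c a T s = 0"
    using underdetermined_system_solution[of S T "\<lambda>t s. exp (c * t * s)"] assms
    unfolding exp_sum_def by auto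
  let ?E = "exp_sum c a T"
  have nz: "?E y \<noteq> 0" if "y \<notin> S" for y
    using card_exp_sum_zeros[OF assms(2,4) a(1), of "insert y S"] a(2) assms that by auto
  have cont: "continuous_on A ?E" for A
    by (meson DERIV_isCont exp_sum_deriv continuous_at_imp_continuous_on)
  obtain S' \<sigma> where S': "S' \<subseteq> S" and \<sigma>: "\<sigma> = 1 \<or> \<sigma> = -1"
    and pos: "\<And>y. y \<notin> S \<Longrightarrow> 0 < \<sigma> * ?E y * (\<Prod>z\<in>S'. y - z)"
    using continuous_sign_pattern[OF assms(1) nz cont] by metis
  have "S' = S"
  proof (rule ccontr)
    assume "S' \<noteq> S"
    then obtain s where s: "s \<in> S" "s \<notin> S'" using S' by auto
    let ?g = "\<lambda>x. \<sigma> * ?E x * (\<Prod>z\<in>S'. x - z)"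
    have gs: "?g s = 0" using a(2) s by simp
    obtain d where d: "((\<lambda>x. \<Prod>z\<in>S'. x - z) has_real_derivative d) (at s)"
    proof -
      have "(\<lambda>x. poly (\<Prod>z\<in>S'. [:- z, 1:]) x) = (\<lambda>x. \<Prod>z\<in>S'. x - z)"
        by (simp add: poly_prod)
      then show thesis using that poly_DERIV by metis
    qed
    have deriv: "(?g has_real_derivative \<sigma> * exp_sum c (\<lambda>t. a t * (c * t)) T s * (\<Prod>z\<in>S'. s - z)) (at s)"
      using a(2)[OF s(1)] by (auto intro!: derivative_eq_intros exp_sum_deriv d)
    have "\<forall>y. \<bar>s - y\<bar> < 1 \<longrightarrow> ?g s \<le> ?g y"
      unfolding gs using pos a(2) by (metis less_eq_real_def mult_zero_left mult_zero_right)
    with deriv zero_less_one have "\<sigma> * exp_sum c (\<lambda>t. a t * (c * t)) T s * (\<Prod>z\<in>S'. s - z) = 0"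
      by (rule DERIV_local_min)
    moreover have "exp_sum c (\<lambda>t. a t * (c * t)) T s \<noteq> 0"
      using exp_sum_zeros_simple[OF assms(2,4) a(1) assms(1)] a(2) assms(3) s by blast
    moreover have "(\<Prod>z\<in>S'. s - z) \<noteq> 0"
      using s S' assms(1) finite_subset by (subst prod_zero_iff) auto
    ultimately show False using \<sigma> by auto
  qed
  have "exp_sum c (\<lambda>t. \<sigma> * a t) T y = \<sigma> * ?E y" for y
    by (simp add: exp_sum_def sum_distrib_left mult.assoc)
  then show thesis using pos \<open>S' = S\<close> by (intro that[of "\<lambda>t. \<sigma> * a t"]) simp
qed

section \<open>Odd-order roots of real polynomials\<close>

lemma poly_even_orders_sign:
  fixes g :: "real poly"
  assumes "g \<noteq> 0" "\<And>x. even (order x g)"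
  obtains \<sigma> where "\<sigma> = 1 \<or> \<sigma> = -1" "\<And>x. 0 \<le> \<sigma> * poly g x"
proof -
  have "\<exists>\<sigma>. (\<sigma> = 1 \<or> \<sigma> = -1) \<and> (\<forall>x. 0 \<le> \<sigma> * poly g x)"
    using assms
  proof (induction "degree g" arbitrary: g rule: less_induct)
    case less
    show ?case
    proof (cases "\<exists>z. poly g z = 0")
      case True
      then obtain z where "poly g z = 0" by auto
      then have "order z g \<noteq> 0" "even (order z g)" using less.prems by (auto simp: order_root)
      then have "2 \<le> order z g" by presburger
      then have "[:- z, 1:] ^ 2 dvd g" by (simp add: order_divides)
      then obtain h where h: "g = [:- z, 1:] ^ 2 * h" by auto
      then have "h \<noteq> 0" using less.prems by auto
      have "degree g = degree ([:- z, 1:] ^ 2) + degree h"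
        unfolding h using \<open>h \<noteq> 0\<close> by (subst degree_mult_eq) auto
      then have deg: "degree h < degree g" by (simp add: degree_power_eq)
      have "order x g = 2 * order x [:- z, 1:] + order x h" for x
        using less.prems(1) unfolding h power2_eq_square
        by (simp add: order_mult del: mult_pCons_left mult_pCons_right)
      then have "even (order x h)" for x using less.prems(2)[of x] by simp
      from less.hyps[OF deg \<open>h \<noteq> 0\<close> this]
      obtain \<sigma> where "\<sigma> = 1 \<or> \<sigma> = -1" "\<forall>x. 0 \<le> \<sigma> * poly h x" by blast
      then have "\<forall>x. 0 \<le> (x - z)^2 * (\<sigma> * poly h x)" by simp
      then have "\<forall>x. 0 \<le> \<sigma> * poly g x" unfolding h by (simp add: algebra_simps)
      then show ?thesis using \<open>\<sigma> = 1 \<or> \<sigma> = -1\<close> by blast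
    next
      case False
      have cont: "continuous_on {a..b} (poly g)" for a b by (intro continuous_intros)
      have "0 < poly g 0 * poly g y" for y
      proof (cases "0 \<le> y")
        case True
        then show ?thesis using False continuous_same_sign[OF _ cont] by blast
      next
        case y: False
        then have "0 < poly g y * poly g 0" using False continuous_same_sign[OF _ cont, of y 0] by simp
        then show ?thesis by (simp add: mult.commute)
      qed
      then have "(\<forall>y. 0 \<le> 1 * poly g y) \<or> (\<forall>y. 0 \<le> -1 * poly g y)"
        by (cases "0 < poly g 0") (simp_all add: zero_less_mult_iff less_imp_le)
      then show ?thesis by blast
    qed
  qed
  then obtain \<sigma> where "\<sigma> = 1 \<or> \<sigma> = -1" "\<forall>x. 0 \<le> \<sigma> * poly g x" by blast
  then show thesis using that[of \<sigma>] by blast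
qed

text \<open>These are the points where the nonzero polynomial \<open>f\<close> changes sign.\<close>

definition odd_roots :: "real poly \<Rightarrow> real set" where
  "odd_roots f = {x. odd (order x f)}"

lemma finite_odd_roots: "f \<noteq> 0 \<Longrightarrow> finite (odd_roots f)"
  by (rule finite_subset[OF _ poly_roots_finite]) (auto simp: odd_roots_def order_root elim: oddE)

lemma order_prod_linear:
  fixes S :: "'a::idom set"
  assumes "finite S"
  shows "order x (\<Prod>s\<in>S. [:- s, 1:]) = (if x \<in> S then 1 else 0)"
proof -
  have "(\<Prod>s\<in>S. [:- s, 1:]) \<noteq> 0" using assms by (simp add: prod_zero_iff)
  then have "order x (\<Prod>s\<in>S. [:- s, 1:]) = count (proots (\<Prod>s\<in>S. [:- s, 1:])) x" by simp
  also have "\<dots> = (\<Sum>s\<in>S. if s = x then 1 else 0)"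
    using assms by (subst proots_prod) (auto simp: count_sum intro!: sum.cong)
  finally show ?thesis using assms by simp
qed

text \<open>One further linear factor at each odd-order root makes all orders even.\<close>

lemma poly_odd_roots_sign:
  fixes f :: "real poly"
  assumes "f \<noteq> 0"
  obtains \<sigma> where "\<sigma> = 1 \<or> \<sigma> = -1"
    "\<And>x. poly f x \<noteq> 0 \<Longrightarrow> 0 < \<sigma> * poly f x * (\<Prod>s\<in>odd_roots f. x - s)"
proof -
  let ?P = "\<Prod>s\<in>odd_roots f. [:- s, 1:]"
  have fin: "finite (odd_roots f)" using finite_odd_roots[OF assms] .
  have P: "?P \<noteq> 0" using fin by (simp add: prod_zero_iff)
  have nz: "f * ?P \<noteq> 0" using assms P by simp
  have "even (order x (f * ?P))" for x
    using nz fin by (subst order_mult) (auto simp: order_prod_linear odd_roots_def)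
  with nz obtain \<sigma> where \<sigma>: "\<sigma> = 1 \<or> \<sigma> = -1" "\<And>x. 0 \<le> \<sigma> * poly (f * ?P) x"
    by (rule poly_even_orders_sign) blast
  have "0 < \<sigma> * poly f x * (\<Prod>s\<in>odd_roots f. x - s)" if "poly f x \<noteq> 0" for x
  proof -
    have "x \<notin> odd_roots f" using that by (auto simp: odd_roots_def order_root elim: oddE)
    then have "(\<Prod>s\<in>odd_roots f. x - s) \<noteq> 0" using fin by (subst prod_zero_iff) auto
    then have "\<sigma> * poly f x * (\<Prod>s\<in>odd_roots f. x - s) \<noteq> 0" using that \<sigma>(1) by auto
    moreover have "0 \<le> \<sigma> * poly f x * (\<Prod>s\<in>odd_roots f. x - s)"
      using \<sigma>(2)[of x] by (simp add: poly_prod mult.assoc)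
    ultimately show ?thesis by (metis less_eq_real_def)
  qed
  then show thesis using that[of \<sigma>] \<sigma>(1) by blast
qed

section \<open>Exponentially coupled weights\<close>

lemma AE_lborel_dense:
  fixes a b :: real
  assumes "AE y in lborel. P y" "a < b"
  obtains y where "a < y" "y < b" "P y"
proof -
  obtain N where N: "{y. \<not> P y} \<subseteq> N" "emeasure lborel N = 0" "N \<in> sets lborel"
    using AE_E[OF assms(1)] by auto
  have "\<not> {a<..<b} \<subseteq> N"
  proof
    assume "{a<..<b} \<subseteq> N"
    then have "emeasure lborel {a<..<b} \<le> emeasure lborel N" using N by (intro emeasure_mono) auto
    then show False using N assms(2) by simp
  qed
  then show thesis using that N(1) by fastforce
qed

lemma AE_lborel_notin_finite:
  fixes Z :: "real set"
  assumes "finite Z"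
  shows "AE x in lborel. x \<notin> Z"
  using assms by (intro AE_not_in finite_imp_null_set_lborel)

lemma lborel_integral_pos:
  fixes h :: "real \<Rightarrow> real"
  assumes "integrable lborel h" "finite Z" "\<And>x. x \<notin> Z \<Longrightarrow> 0 < h x"
  shows "0 < integral\<^sup>L lborel h"
proof (rule ccontr)
  assume not_pos: "\<not> 0 < integral\<^sup>L lborel h"
  have pos: "AE x in lborel. 0 < h x"
    using AE_lborel_notin_finite[OF assms(2)] by eventually_elim (use assms(3) in auto)
  then have nonneg: "AE x in lborel. 0 \<le> h x" by eventually_elim simp
  then have "integral\<^sup>L lborel h = 0"
    using not_pos integral_nonneg_AE[OF nonneg] by linarith
  then have "AE x in lborel. h x = 0"
    using integral_nonneg_eq_0_iff_AE[OF assms(1) nonneg] by simp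
  with pos have "AE x in (lborel :: real measure). False" by eventually_elim simp
  then show False by (rule AE_lborel_dense[OF _ zero_less_one])
qed

lemma borel_measurable_poly [measurable]: "poly f \<in> borel_measurable (borel :: real measure)"
  by (intro borel_measurable_continuous_onI continuous_intros)

lemma exp_between:
  fixes s y1 y y2 :: real
  assumes "y1 \<le> y" "y \<le> y2"
  shows "exp (s * y) \<le> exp (s * y1) + exp (s * y2)"
proof (cases "0 \<le> s")
  case True
  then have "exp (s * y) \<le> exp (s * y2)" using assms by (simp add: mult_left_mono)
  then show ?thesis using exp_gt_zero[of "s * y1"] by linarith
next
  case False
  then have "exp (s * y) \<le> exp (s * y1)" using assms by (simp add: mult_left_mono_neg)
  then show ?thesis using exp_gt_zero[of "s * y2"] by linarith
qed

text \<open>The factors \<open>u\<close> and \<open>v\<close> stand for \<open>exp (- n V)\<close> and \<open>exp (- n W)\<close>, and \<open>c\<close> for \<open>n \<tau>\<close>. The factors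
  enter symmetrically, so every fact about the first polynomial of a pairing also holds for the second one,
  by interchanging \<open>u\<close> and \<open>v\<close>.\<close>

locale exp_coupled_weights =
  fixes u v :: "real \<Rightarrow> real" and c :: real
  assumes u_measurable [measurable]: "u \<in> borel_measurable borel"
    and v_measurable [measurable]: "v \<in> borel_measurable borel"
    and u_pos: "\<And>x. 0 < u x" and v_pos: "\<And>y. 0 < v y" and c_nonzero: "c \<noteq> 0"
    and moments: "\<And>k j. integrable (lborel \<Otimes>\<^sub>M lborel)
      (\<lambda>(x, y). x ^ k * y ^ j * (u x * v y * exp (c * x * y)))"
begin

definition pairing :: "real poly \<Rightarrow> real poly \<Rightarrow> real" where
  "pairing f g = (LINT (x, y)|(lborel \<Otimes>\<^sub>M lborel).
     poly f x * poly g y * (u x * v y * exp (c * x * y)))"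

definition transform :: "real poly \<Rightarrow> real \<Rightarrow> real" where
  "transform f y = (LINT x|lborel. poly f x * u x * exp (c * x * y))"

lemma integrable_pairing:
  "integrable (lborel \<Otimes>\<^sub>M lborel) (\<lambda>(x, y). poly f x * poly g y * (u x * v y * exp (c * x * y)))"
proof -
  have "poly f x * poly g y * w = (\<Sum>i\<le>degree f. \<Sum>j\<le>degree g. (coeff f i * coeff g j) * (x ^ i * y ^ j * w))"
    for x y w
    unfolding poly_altdef sum_product sum_distrib_right
    by (intro sum.cong refl) (simp add: sum_distrib_left mult_ac)
  then have "(\<lambda>(x, y). poly f x * poly g y * (u x * v y * exp (c * x * y))) =
    (\<lambda>z. \<Sum>i\<le>degree f. \<Sum>j\<le>degree g. (coeff f i * coeff g j) *
      (case z of (x, y) \<Rightarrow> x ^ i * y ^ j * (u x * v y * exp (c * x * y))))"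
    by (simp add: fun_eq_iff)
  then show ?thesis using moments by (auto intro!: Bochner_Integration.integrable_sum)
qed

lemma pairing_add_left: "pairing (f + g) h = pairing f h + pairing g h"
  unfolding pairing_def
  by (subst Bochner_Integration.integral_add[symmetric, OF integrable_pairing integrable_pairing])
    (auto simp: algebra_simps intro!: Bochner_Integration.integral_cong)

lemma pairing_smult_left: "pairing (smult a f) h = a * pairing f h"
proof -
  have "(\<lambda>(x, y). poly (smult a f) x * poly h y * (u x * v y * exp (c * x * y))) =
      (\<lambda>z. a * (case z of (x, y) \<Rightarrow> poly f x * poly h y * (u x * v y * exp (c * x * y))))"
    by (auto simp: fun_eq_iff mult.assoc)
  then show ?thesis unfolding pairing_def by (simp only: integral_mult_right_zero)
qed

lemma exp_coupled_weights_swap: "exp_coupled_weights v u c"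
proof
  fix k j
  show "integrable (lborel \<Otimes>\<^sub>M lborel) (\<lambda>(x, y). x ^ k * y ^ j * (v x * u y * exp (c * x * y)))"
    using lborel_pair.integrable_product_swap[OF moments[of j k]]
    by (simp add: case_prod_unfold mult_ac)
qed (use u_pos v_pos c_nonzero in auto)

lemma pairing_swap: "exp_coupled_weights.pairing v u c g f = pairing f g"
proof -
  interpret swap: exp_coupled_weights v u c by (rule exp_coupled_weights_swap)
  have "(\<lambda>(x, y). poly f x * poly g y * (u x * v y * exp (c * x * y))) \<in>
      borel_measurable (lborel \<Otimes>\<^sub>M lborel)"
    using integrable_pairing[of f g] by (rule borel_measurable_integrable)
  from lborel_pair.integral_product_swap[OF this] show ?thesis
    unfolding pairing_def swap.pairing_def by (simp add: case_prod_unfold mult_ac)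
qed

lemma pairing_add_right: "pairing h (f + g) = pairing h f + pairing h g"
proof -
  interpret swap: exp_coupled_weights v u c by (rule exp_coupled_weights_swap)
  show ?thesis using swap.pairing_add_left[of f g h] by (simp add: pairing_swap)
qed

lemma pairing_smult_right: "pairing h (smult a f) = a * pairing h f"
proof -
  interpret swap: exp_coupled_weights v u c by (rule exp_coupled_weights_swap)
  show ?thesis using swap.pairing_smult_left[of a f h] by (simp add: pairing_swap)
qed

text \<open>Fubini gives integrability for almost every \<open>y\<close> only. Such \<open>y\<close> are found on both sides of any given
  point, and the exponential is dominated by the sum of the exponentials at two surrounding parameters;
  so integrability holds for every \<open>y\<close>.\<close>

lemma integrable_slice: "integrable lborel (\<lambda>x. poly f x * u x * exp (c * x * y))"
proof -
  have "AE z in lborel. integrable lborel (\<lambda>x. poly f x * poly 1 z * (u x * v z * exp (c * x * z)))"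
    by (rule lborel_pair.AE_integrable_snd[OF integrable_pairing])
  then have ae: "AE z in lborel. integrable lborel (\<lambda>x. poly f x * u x * exp (c * x * z))"
  proof eventually_elim
    case (elim z)
    then have "integrable lborel (\<lambda>x. inverse (v z) *
        (poly f x * poly 1 z * (u x * v z * exp (c * x * z))))"
      by (rule integrable_mult_right)
    moreover have "(\<lambda>x. inverse (v z) * (poly f x * poly 1 z * (u x * v z * exp (c * x * z)))) =
        (\<lambda>x. poly f x * u x * exp (c * x * z))"
      using v_pos[of z] by (auto simp: field_simps)
    ultimately show ?case by (simp only:)
  qed
  obtain y1 where y1: "y1 < y" "integrable lborel (\<lambda>x. poly f x * u x * exp (c * x * y1))"
    by (rule AE_lborel_dense[OF ae, of "y - 1" y]) auto
  obtain y2 where y2: "y < y2" "integrable lborel (\<lambda>x. poly f x * u x * exp (c * x * y2))"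
    by (rule AE_lborel_dense[OF ae, of y "y + 1"]) auto
  show ?thesis
  proof (rule Bochner_Integration.integrable_bound)
    show "integrable lborel (\<lambda>x. \<bar>poly f x * u x * exp (c * x * y1)\<bar> + \<bar>poly f x * u x * exp (c * x * y2)\<bar>)"
      using y1 y2 by auto
    show "(\<lambda>x. poly f x * u x * exp (c * x * y)) \<in> borel_measurable lborel" by measurable
    have "\<bar>poly f x * u x\<bar> * exp (c * x * y) \<le> \<bar>poly f x * u x\<bar> * (exp (c * x * y1) + exp (c * x * y2))" for x
      using exp_between[of y1 y y2 "c * x"] y1 y2 by (intro mult_left_mono) auto
    then show "AE x in lborel. norm (poly f x * u x * exp (c * x * y)) \<le>
        norm (\<bar>poly f x * u x * exp (c * x * y1)\<bar> + \<bar>poly f x * u x * exp (c * x * y2)\<bar>)"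
      by (intro AE_I2) (simp add: abs_mult algebra_simps)
  qed
qed

lemma continuous_on_transform: "continuous_on {a..b} (transform f)"
  unfolding continuous_on_sequentially
proof (intro allI impI ballI, elim conjE)
  fix y :: "nat \<Rightarrow> real" and y0
  assume y: "\<forall>n. y n \<in> {a..b}" "y \<longlonglongrightarrow> y0"
  let ?w = "\<lambda>x. \<bar>poly f x * u x * exp (c * x * a)\<bar> + \<bar>poly f x * u x * exp (c * x * b)\<bar>"
  have "(\<lambda>n. LINT x|lborel. poly f x * u x * exp (c * x * y n)) \<longlonglongrightarrow>
      (LINT x|lborel. poly f x * u x * exp (c * x * y0))"
  proof (rule integral_dominated_convergence[where w = ?w])
    show "integrable lborel ?w" using integrable_slice by auto
    show "AE x in lborel. (\<lambda>n. poly f x * u x * exp (c * x * y n)) \<longlonglongrightarrow> poly f x * u x * exp (c * x * y0)"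
      using y by (intro AE_I2 tendsto_intros)
    fix n
    have "\<bar>poly f x * u x\<bar> * exp (c * x * y n) \<le> \<bar>poly f x * u x\<bar> * (exp (c * x * a) + exp (c * x * b))" for x
      using exp_between[of a "y n" b "c * x"] y by (intro mult_left_mono) auto
    then show "AE x in lborel. norm (poly f x * u x * exp (c * x * y n)) \<le> ?w x"
      by (intro AE_I2) (simp add: abs_mult algebra_simps)
  qed measurable
  then show "(transform f \<circ> y) \<longlonglongrightarrow> transform f y0" by (simp add: transform_def o_def)
qed

text \<open>The transform is variation diminishing. If it vanished at more points \<open>t\<close> than \<open>f\<close> has sign changes, some
  exponential sum with these frequencies would have exactly the sign changes of \<open>f\<close>. Integrating it
  against \<open>f u\<close> gives a combination of the values \<open>transform f t = 0\<close>, although the integrand has one sign.\<close>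

lemma card_transform_zeros:
  assumes "f \<noteq> 0" "finite T" "\<And>t. t \<in> T \<Longrightarrow> transform f t = 0"
  shows "card T \<le> card (odd_roots f)"
proof (rule ccontr)
  assume "\<not> ?thesis"
  then obtain T' where T': "T' \<subseteq> T" "card T' = card (odd_roots f) + 1" "finite T'"
    using obtain_subset_with_card_n[of "card (odd_roots f) + 1" T] by auto
  obtain a where a: "\<And>x. x \<notin> odd_roots f \<Longrightarrow>
      0 < exp_sum c a T' x * (\<Prod>s\<in>odd_roots f. x - s)"
    using exp_sum_prescribed_sign_changes[OF finite_odd_roots[OF assms(1)] T'(3,2) c_nonzero] by blast
  obtain \<sigma> where \<sigma>: "\<sigma> = 1 \<or> \<sigma> = -1"
    "\<And>x. poly f x \<noteq> 0 \<Longrightarrow> 0 < \<sigma> * poly f x * (\<Prod>s\<in>odd_roots f. x - s)"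
    by (rule poly_odd_roots_sign[OF assms(1)]) blast
  let ?h = "\<lambda>x. \<Sum>t\<in>T'. \<sigma> * a t * (poly f x * u x * exp (c * x * t))"
  have "0 < integral\<^sup>L lborel ?h"
  proof (rule lborel_integral_pos)
    show "integrable lborel ?h" using integrable_slice by auto
    show "finite {x. poly f x = 0}" using assms(1) by (rule poly_roots_finite)
    fix x assume "x \<notin> {x. poly f x = 0}"
    then have x: "poly f x \<noteq> 0" "x \<notin> odd_roots f"
      by (auto simp: odd_roots_def order_root elim: oddE)
    let ?P = "\<Prod>s\<in>odd_roots f. x - s"
    \<comment> \<open>\<open>f\<close> and the exponential sum both have the sign pattern of \<open>?P\<close>, which enters the product as a square\<close>
    have "0 < (\<sigma> * poly f x * ?P) * (exp_sum c a T' x * ?P)"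
      using \<sigma>(2)[OF x(1)] a[OF x(2)] by (rule mult_pos_pos)
    also have "\<dots> = (\<sigma> * poly f x * exp_sum c a T' x) * ?P\<^sup>2"
      by (simp add: power2_eq_square)
    finally have "0 < \<sigma> * poly f x * exp_sum c a T' x"
      by (metis mult_le_0_iff not_le zero_le_power2)
    then have "0 < \<sigma> * poly f x * exp_sum c a T' x * u x" using u_pos by simp
    also have "\<dots> = ?h x"
      by (simp add: exp_sum_def sum_distrib_left sum_distrib_right mult_ac)
    finally show "0 < ?h x" .
  qed
  moreover have "integral\<^sup>L lborel ?h = (\<Sum>t\<in>T'. \<sigma> * a t * transform f t)"
    using integrable_slice unfolding transform_def by (subst Bochner_Integration.integral_sum) auto
  moreover have "\<dots> = 0" using assms(3) T'(1) by (intro sum.neutral) auto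
  ultimately show False by simp
qed

lemma pairing_eq_transform:
  "pairing f g = (LINT y|lborel. transform f y * poly g y * v y)"
  "integrable lborel (\<lambda>y. transform f y * poly g y * v y)"
proof -
  let ?k = "\<lambda>x y. poly f x * poly g y * (u x * v y * exp (c * x * y))"
  have inner: "(LINT x|lborel. ?k x y) = transform f y * poly g y * v y" for y
  proof -
    have "(LINT x|lborel. ?k x y) = (LINT x|lborel. (poly f x * u x * exp (c * x * y)) * (poly g y * v y))"
      by (simp add: mult_ac)
    also have "\<dots> = transform f y * (poly g y * v y)"
      unfolding transform_def by (rule integral_mult_left_zero)
    finally show ?thesis by (simp add: mult.assoc)
  qed
  show "pairing f g = (LINT y|lborel. transform f y * poly g y * v y)"
    using lborel_pair.integral_snd[OF integrable_pairing[of f g]] by (simp add: inner pairing_def)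
  show "integrable lborel (\<lambda>y. transform f y * poly g y * v y)"
    using lborel_pair.integrable_snd[OF integrable_pairing[of f g]] by (simp add: inner)
qed

text \<open>The transform of \<open>f\<close> changes sign at most as often as \<open>f\<close> does. If that were fewer than \<open>k\<close> times, the
  polynomial with the same sign changes as the transform would have degree below \<open>k\<close>, and its pairing
  with \<open>f\<close> would be the integral of a function of one sign.\<close>

lemma card_odd_roots_ge:
  assumes "f \<noteq> 0" and orth: "\<And>g. degree g < k \<Longrightarrow> pairing f g = 0"
  shows "k \<le> card (odd_roots f)"
proof (rule ccontr)
  assume "\<not> ?thesis"
  then have less: "card (odd_roots f) < k" by simp
  let ?Z = "{y. transform f y = 0}"
  have small: "card T \<le> card (odd_roots f)" if "finite T" "T \<subseteq> ?Z" for T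
    using card_transform_zeros[OF assms(1) that(1)] that(2) by auto
  have fin: "finite ?Z"
    using infinite_arbitrarily_large[of ?Z "card (odd_roots f) + 1"] small by force
  obtain S \<sigma> where S: "S \<subseteq> ?Z" and \<sigma>: "\<sigma> = 1 \<or> \<sigma> = -1"
    and pos: "\<And>y. y \<notin> ?Z \<Longrightarrow> 0 < \<sigma> * transform f y * (\<Prod>z\<in>S. y - z)"
    by (rule continuous_sign_pattern[OF fin _ continuous_on_transform]) auto
  let ?Q = "\<Prod>z\<in>S. [:- z, 1:]"
  have "degree ?Q = card S" by (subst degree_prod_eq_sum_degree) auto
  also have "\<dots> < k" using small[of S] S fin finite_subset less by fastforce
  finally have "pairing f (smult \<sigma> ?Q) = 0" by (simp add: orth pairing_smult_right)
  moreover have "0 < (LINT y|lborel. transform f y * poly (smult \<sigma> ?Q) y * v y)"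
  proof (rule lborel_integral_pos[OF pairing_eq_transform(2) fin])
    fix y assume "y \<notin> ?Z"
    then have "0 < \<sigma> * transform f y * (\<Prod>z\<in>S. y - z) * v y" using pos v_pos by simp
    then show "0 < transform f y * poly (smult \<sigma> ?Q) y * v y" by (simp add: poly_prod mult_ac)
  qed
  ultimately show False by (simp add: pairing_eq_transform(1))
qed

end

section \<open>Interlacing from a non-vanishing Wronskian\<close>

definition wronskian :: "real poly \<Rightarrow> real poly \<Rightarrow> real poly" where
  "wronskian f g = f * pderiv g - pderiv f * g"

text \<open>Sturm separation: if \<open>f\<close> had no root between two roots of \<open>g\<close>, Rolle's theorem would apply to
  \<open>g / f\<close>, whose derivative is the Wronskian divided by \<open>f\<^sup>2\<close>.\<close>

lemma root_between_roots:
  assumes "a < b" "poly g a = 0" "poly g b = 0"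
    and W: "\<And>x. a \<le> x \<Longrightarrow> x \<le> b \<Longrightarrow> poly (wronskian f g) x \<noteq> 0"
  shows "\<exists>z. a < z \<and> z < b \<and> poly f z = 0"
proof (rule ccontr)
  assume no_root: "\<not> (\<exists>z. a < z \<and> z < b \<and> poly f z = 0)"
  have nz: "poly f x \<noteq> 0" if "a \<le> x" "x \<le> b" for x
  proof
    assume "poly f x = 0"
    moreover have "x \<noteq> a" "x \<noteq> b"
      using W[of a] W[of b] assms(1-3) \<open>poly f x = 0\<close> by (auto simp: wronskian_def)
    ultimately show False using that no_root by (metis order_le_less)
  qed
  define h where "h x = poly g x / poly f x" for x
  have deriv: "(h has_real_derivative poly (wronskian f g) x / (poly f x)\<^sup>2) (at x)"
    if "a \<le> x" "x \<le> b" for x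
    unfolding h_def using nz[OF that]
    by (auto intro!: derivative_eq_intros simp: wronskian_def power2_eq_square field_simps)
  have "\<exists>z. a < z \<and> z < b \<and> DERIV h z :> 0"
  proof (rule Rolle)
    show "h a = h b" using assms by (simp add: h_def)
    show "continuous_on {a..b} h"
      using deriv by (auto intro!: continuous_at_imp_continuous_on DERIV_isCont)
    show "\<And>x. a < x \<Longrightarrow> x < b \<Longrightarrow> h differentiable (at x)"
      using deriv real_differentiable_def by (meson less_imp_le)
  qed (use assms in auto)
  then obtain z where z: "a < z" "z < b" "DERIV h z :> 0" by auto
  then have "poly (wronskian f g) z / (poly f z)\<^sup>2 = 0"
    using DERIV_unique[OF deriv[of z] z(3)] by simp
  then show False using W[of z] nz[of z] z by auto
qed

text \<open>Each of the gaps between neighbouring roots of \<open>g\<close> contains a root of \<open>f\<close>. There are as many gaps as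
  roots of \<open>f\<close>, so this accounts for all of them. The roots are restricted to an interval in order to
  cover the positive roots alone as well.\<close>

lemma interlace_of_wronskian:
  fixes f g :: "real poly" and I :: "real set"
  defines "A \<equiv> {x \<in> I. poly f x = 0}" and "B \<equiv> {x \<in> I. poly g x = 0}"
  assumes "is_interval I" and W: "\<And>x. x \<in> I \<Longrightarrow> poly (wronskian f g) x \<noteq> 0"
    and fin: "finite A" "finite B" and card: "card B = card A + 1"
  obtains \<alpha> \<beta> where "mset \<alpha> = mset_set A" "mset \<beta> = mset_set B" "interlace \<alpha> \<beta>"
proof -
  define \<beta> where "\<beta> = sorted_list_of_set B"
  have \<beta>: "set \<beta> = B" "length \<beta> = card A + 1" "mset \<beta> = mset_set B"
    using fin card by (simp_all add: \<beta>_def flip: mset_set_set)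
  have mono: "\<beta> ! i < \<beta> ! j" if "i < j" "j < card A + 1" for i j
    using sorted_wrt_nth_less[OF strict_sorted_list_of_set[of B, folded \<beta>_def]] that \<beta>(2) by simp
  have "\<exists>z. \<beta> ! i < z \<and> z < \<beta> ! (i + 1) \<and> z \<in> A" if i: "i < card A" for i
  proof -
    have mem: "\<beta> ! i \<in> B" "\<beta> ! (i + 1) \<in> B" 
      using \<beta>(1,2) that by (metis nth_mem add_less_cancel_right trans_less_add1)+
    have I: "x \<in> I" if "\<beta> ! i \<le> x" "x \<le> \<beta> ! (i + 1)" for x
      using mem_is_interval_1_I[OF \<open>is_interval I\<close> _ _ that] mem by (simp add: B_def)
    obtain z where "\<beta> ! i < z" "z < \<beta> ! (i + 1)" "poly f z = 0"
      using root_between_roots[of "\<beta> ! i" "\<beta> ! (i + 1)" g f] mono[of i "i + 1"] mem W I i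
      by (auto simp: B_def)
    then show ?thesis using I[of z] by (auto simp: A_def)
  qed
  then obtain z where z: "\<And>i. i < card A \<Longrightarrow> \<beta> ! i < z i \<and> z i < \<beta> ! (i + 1) \<and> z i \<in> A"
    by metis
  have z_mono: "z i < z j" if "i < j" "j < card A" for i j
  proof -
    have "\<beta> ! (i + 1) \<le> \<beta> ! j" using mono[of "i + 1" j] that by (cases "i + 1 = j") auto
    then show ?thesis using z[of i] z[of j] that by simp
  qed
  define \<alpha> where "\<alpha> = map z [0..<card A]"
  have inj: "inj_on z {0..<card A}"
    by (rule inj_onI) (metis atLeastLessThan_iff linorder_neqE_nat order_less_irrefl z_mono)
  then have "card (z ` {0..<card A}) = card A" by (simp add: card_image)
  moreover have "z ` {0..<card A} \<subseteq> A" using z by auto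
  ultimately have "z ` {0..<card A} = A" using fin card_subset_eq by blast
  then have "set \<alpha> = A" "distinct \<alpha>" using inj by (simp_all add: \<alpha>_def distinct_map)
  then have "mset \<alpha> = mset_set A" using mset_set_set by metis
  moreover have "interlace \<alpha> \<beta>" unfolding interlace_def using z \<beta>(2) by (simp add: \<alpha>_def)
  ultimately show thesis using that \<beta>(3) by blast
qed

text \<open>The Wronskian is the determinant of the two linear conditions on \<open>(a, b)\<close> that make \<open>x\<close> a root of
  \<open>a f + b g\<close> and of its derivative.\<close>

lemma double_root_of_wronskian_root:
  assumes "poly (wronskian f g) x = 0"
  obtains a b where "a \<noteq> 0 \<or> b \<noteq> 0" "poly (smult a f + smult b g) x = 0"
    "poly (pderiv (smult a f + smult b g)) x = 0"
proof -
  have W: "poly f x * poly (pderiv g) x = poly (pderiv f) x * poly g x"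
    using assms by (simp add: wronskian_def)
  consider "poly f x \<noteq> 0 \<or> poly g x \<noteq> 0"
    | "poly f x = 0" "poly g x = 0" "poly (pderiv f) x \<noteq> 0 \<or> poly (pderiv g) x \<noteq> 0"
    | "poly f x = 0" "poly g x = 0" "poly (pderiv f) x = 0" "poly (pderiv g) x = 0" by blast
  then show thesis
  proof cases
    case 1
    then show ?thesis
      using W by (intro that[of "poly g x" "- poly f x"]) (auto simp: pderiv_diff pderiv_smult algebra_simps)
  next
    case 2
    then show ?thesis
      by (intro that[of "poly (pderiv g) x" "- poly (pderiv f) x"]) (auto simp: pderiv_diff pderiv_smult algebra_simps)
  next
    case 3
    then show ?thesis by (intro that[of 1 0]) auto
  qed
qed

lemma double_root_order:
  fixes f :: "real poly"
  assumes "f \<noteq> 0" "poly f x = 0" "poly (pderiv f) x = 0"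
  shows "2 \<le> order x f"
proof -
  have "pderiv f \<noteq> 0"
  proof
    assume "pderiv f = 0"
    then obtain h where "f = [:h:]" using pderiv_iszero by blast
    then show False using assms by simp
  qed
  then have "order x (pderiv f) \<noteq> 0" using assms(3) by (simp add: order_root)
  then show ?thesis using order_pderiv[OF assms(1,2)] by simp
qed

lemma poly_map_poly_of_real:
  "poly (map_poly of_real f) (complex_of_real x) = of_real (poly f x)"
  by (induction f) (auto simp: map_poly_pCons)

text \<open>The complex zeros, counted with multiplicity, are at most \<open>degree f\<close> many; if that many distinct real
  ones are already known, there are no others.\<close>

lemma zeros_of_real_rooted:
  assumes "f \<noteq> 0" "card {x. poly f x = 0} = degree f"
  shows "zeros f = image_mset complex_of_real (mset_set {x. poly f x = 0})"
proof -
  let ?A = "{x. poly f x = 0}" and ?F = "map_poly complex_of_real f"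
  have F: "?F \<noteq> 0" "degree ?F = degree f"
    using assms(1) by (auto simp: map_poly_eq_0_iff degree_map_poly)
  have fin: "finite ?A" using assms(1) by (rule poly_roots_finite)
  have "image_mset complex_of_real (mset_set ?A) = mset_set (complex_of_real ` ?A)"
    by (intro image_mset_mset_set) (auto simp: inj_on_def)
  also have "\<dots> = proots ?F"
  proof -
    let ?X = "mset_set (complex_of_real ` ?A)"
    have "complex_of_real ` ?A \<subseteq> set_mset (proots ?F)"
      using F(1) by (auto simp: poly_map_poly_of_real)
    then have "?X \<subseteq># mset_set (set_mset (proots ?F))"
      using fin by (simp add: msubset_mset_set_iff)
    then have sub: "?X \<subseteq># proots ?F"
      using mset_set_set_mset_msubset subset_mset.order_trans by blast
    have "size ?X = degree f"
      using assms(2) by (simp add: card_image inj_on_def)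
    then have "\<not> ?X \<subset># proots ?F" using mset_subset_size size_proots_le[of ?F] F(2) by fastforce
    then show ?thesis using sub by (simp add: subset_mset.less_le)
  qed
  finally show ?thesis by (simp add: zeros_def)
qed

lemma zeros_interlace_of_wronskian:
  fixes f g :: "real poly" and I :: "real set"
  defines "A \<equiv> {x \<in> I. poly f x = 0}" and "B \<equiv> {x \<in> I. poly g x = 0}"
  assumes "is_interval I" and W: "\<And>x. x \<in> I \<Longrightarrow> poly (wronskian f g) x \<noteq> 0"
    and fin: "finite A" "finite B" and card: "card B = card A + 1"
  shows "zeros_interlace (image_mset complex_of_real (mset_set A))
    (image_mset complex_of_real (mset_set B))"
proof -
  obtain \<alpha> \<beta> where "mset \<alpha> = mset_set A" "mset \<beta> = mset_set B" "interlace \<alpha> \<beta>"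
    using interlace_of_wronskian[OF assms(3) W fin[unfolded A_def B_def] card[unfolded A_def B_def]]
    unfolding A_def B_def by blast
  then show ?thesis unfolding zeros_interlace_def by (metis mset_map)
qed

section \<open>Biorthogonal polynomials\<close>

abbreviation poly_reflect :: "real poly \<Rightarrow> real poly" where
  "poly_reflect f \<equiv> f \<circ>\<^sub>p [:0, -1:]"

lemma coeff_poly_reflect: "coeff (poly_reflect f) i = (-1) ^ i * coeff f i"
  by (simp add: coeff_pcompose_linear)

lemma poly_reflect_poly_reflect: "poly_reflect (poly_reflect f) = f"
  by (rule poly_eqI) (simp only: coeff_poly_reflect mult.assoc[symmetric] power_mult_distrib[symmetric], simp)

context exp_coupled_weights
begin

text \<open>At least \<open>k\<close> roots have odd order and each counts once towards the degree. A multiple root counts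
  twice more: its order is at least \<open>2\<close>, and at least \<open>3\<close> when it is odd.\<close>

lemma degree_ge_of_orthogonal:
  assumes "f \<noteq> 0" and orth: "\<And>g. degree g < k \<Longrightarrow> pairing f g = 0"
    and D: "finite D" "\<And>x. x \<in> D \<Longrightarrow> 2 \<le> order x f"
  shows "k + 2 * card D \<le> degree f"
proof -
  let ?R = "{x. poly f x = 0}"
  have fin: "finite ?R" using assms(1) by (rule poly_roots_finite)
  have sub: "odd_roots f \<subseteq> ?R" "D \<subseteq> ?R"
    using D(2) by (auto simp: odd_roots_def order_root elim: oddE) (metis not_numeral_le_zero order_root)
  have "k + 2 * card D \<le> card (odd_roots f) + 2 * card D"
    using card_odd_roots_ge[OF assms(1) orth] by simp
  also have "\<dots> = (\<Sum>x\<in>?R. of_bool (x \<in> odd_roots f) + 2 * of_bool (x \<in> D))"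
    using fin sub by (simp add: sum.distrib Int_absorb1 flip: sum_distrib_left)
  also have "\<dots> \<le> (\<Sum>x\<in>?R. order x f)"
  proof (rule sum_mono)
    fix x assume "x \<in> ?R"
    show "of_bool (x \<in> odd_roots f) + 2 * of_bool (x \<in> D) \<le> order x f"
    proof (cases "x \<in> D")
      case True
      then show ?thesis using D(2)[OF True] by (cases "order x f = 2") (auto simp: odd_roots_def)
    next
      case False
      then show ?thesis by (auto simp: odd_roots_def elim: oddE)
    qed
  qed
  also have "\<dots> \<le> degree f" using sum_order_le_degree[OF assms(1)] .
  finally show ?thesis .
qed

end

locale biorthogonal_polys = exp_coupled_weights +
  fixes p q :: "nat \<Rightarrow> real poly"
  assumes p_monic: "\<And>k. lead_coeff (p k) = 1" and p_degree: "\<And>k. degree (p k) = k"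
    and q_monic: "\<And>k. lead_coeff (q k) = 1" and q_degree: "\<And>k. degree (q k) = k"
    and biorthogonal: "\<And>k j. k \<noteq> j \<Longrightarrow> pairing (p k) (q j) = 0"
begin

lemma p_coeff: "coeff (p k) k = 1" and q_coeff: "coeff (q k) k = 1"
  using p_monic[of k] q_monic[of k] by (simp_all add: p_degree q_degree)

lemma biorthogonal_polys_swap: "biorthogonal_polys v u c q p"
proof -
  interpret swap: exp_coupled_weights v u c by (rule exp_coupled_weights_swap)
  show ?thesis
    by unfold_locales (auto simp: p_coeff p_degree q_coeff q_degree biorthogonal pairing_swap)
qed

lemma pairing_zero_right: "pairing f 0 = 0"
  using pairing_smult_right[of f 0 0] by simp

lemma orthogonal_lower_degree:
  assumes "\<And>j. j < k \<Longrightarrow> pairing f (q j) = 0" and "degree g < k"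
  shows "pairing f g = 0"
proof -
  have "\<forall>i\<ge>k. coeff g i = 0" using assms(2) by (auto intro: coeff_eq_0)
  then show ?thesis using assms(1)
  proof (induction k arbitrary: g)
    case 0
    then have "g = 0" by (intro poly_eqI) simp
    then show ?case by (simp add: pairing_zero_right)
  next
    case (Suc k)
    define h where "h = g + smult (- coeff g k) (q k)"
    have "coeff h i = 0" if "i \<ge> k" for i
      using that Suc.prems(1) q_coeff[of k] q_degree[of k]
      by (cases "i = k") (auto simp: h_def coeff_eq_0)
    then have "pairing f h = 0" using Suc.IH[of h] Suc.prems(2) by auto
    moreover have "g = h + smult (coeff g k) (q k)" by (simp add: h_def)
    ultimately show ?case
      using Suc.prems(2)[of k] by (metis add.right_neutral lessI mult_zero_right pairing_add_right pairing_smult_right)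
  qed
qed

lemma p_orthogonal: "degree g < k \<Longrightarrow> pairing (p k) g = 0"
  by (rule orthogonal_lower_degree[of k]) (simp_all add: biorthogonal)

lemma card_p_roots: "card {x. poly (p k) x = 0} = k"
proof -
  have nz: "p k \<noteq> 0" using p_monic[of k] by auto
  have "odd_roots (p k) \<subseteq> {x. poly (p k) x = 0}"
    by (auto simp: odd_roots_def order_root elim: oddE)
  then have "card (odd_roots (p k)) \<le> card {x. poly (p k) x = 0}"
    using poly_roots_finite[OF nz] card_mono by blast
  then show ?thesis
    using card_odd_roots_ge[OF nz p_orthogonal] card_poly_roots_bound[OF nz] p_degree[of k]
    by (metis le_antisym le_trans)
qed

lemma finite_p_roots: "finite {x. poly (p k) x = 0}"
  using p_monic[of k] by (intro poly_roots_finite) auto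

lemma zeros_p: "zeros (p k) = image_mset complex_of_real (mset_set {x. poly (p k) x = 0})"
  using p_monic[of k] by (intro zeros_of_real_rooted) (auto simp: card_p_roots p_degree)

text \<open>A nontrivial combination of \<open>p k\<close> and \<open>p l\<close> is still orthogonal to everything of degree below \<open>k\<close>, while its
  degree is at most \<open>l\<close>. This leaves room for at most \<open>(l - k) / 2\<close> multiple real roots.\<close>

lemma combination_multiple_roots:
  assumes "k < l" "a \<noteq> 0 \<or> b \<noteq> 0" and f: "f = smult a (p k) + smult b (p l)"
    and D: "finite D" "\<And>x. x \<in> D \<Longrightarrow> poly f x = 0 \<and> poly (pderiv f) x = 0"
  shows "k + 2 * card D \<le> l"
proof -
  have "coeff f l = b" "b = 0 \<Longrightarrow> coeff f k = a"
    using p_coeff[of k] p_coeff[of l] p_degree[of k] p_degree[of l] assms(1)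
    by (simp_all add: f coeff_eq_0)
  then have "f \<noteq> 0" using assms(2) by auto
  have "pairing f g = 0" if "degree g < k" for g
    using p_orthogonal[of g k] p_orthogonal[of g l] that assms(1)
    by (simp add: f pairing_add_left pairing_smult_left)
  moreover have "2 \<le> order x f" if "x \<in> D" for x
    using D(2)[OF that] \<open>f \<noteq> 0\<close> by (intro double_root_order) auto
  ultimately have "k + 2 * card D \<le> degree f"
    using degree_ge_of_orthogonal \<open>f \<noteq> 0\<close> D(1) by blast
  also have "\<dots> \<le> l" using assms(1) by (auto simp: f p_degree intro!: degree_add_le degree_smult_le[THEN le_trans])
  finally show ?thesis .
qed

lemma consecutive_zeros_interlace: "zeros_interlace (zeros (p k)) (zeros (p (k + 1)))"
proof -
  have "poly (wronskian (p k) (p (k + 1))) x \<noteq> 0" for x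
  proof
    assume "poly (wronskian (p k) (p (k + 1))) x = 0"
    then obtain a b where "a \<noteq> 0 \<or> b \<noteq> 0" "poly (smult a (p k) + smult b (p (k + 1))) x = 0"
        "poly (pderiv (smult a (p k) + smult b (p (k + 1)))) x = 0"
      by (rule double_root_of_wronskian_root)
    then have "k + 2 * card {x} \<le> k + 1"
      by (intro combination_multiple_roots[of k "k + 1" a b, OF _ _ refl]) auto
    then show False by simp
  qed
  then show ?thesis
    using zeros_interlace_of_wronskian[of UNIV "p k" "p (k + 1)"]
    by (simp add: zeros_p card_p_roots finite_p_roots)
qed

context
  assumes reflect: "\<And>f g. pairing (poly_reflect f) (poly_reflect g) = pairing f g"
begin

text \<open>Reflection invariance makes the reflected polynomial orthogonal to the same space, so its difference
  from \<open>(-1) ^ k * p k\<close> is orthogonal to all degrees below \<open>k\<close> while having itself degree below \<open>k\<close>.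
  Such a polynomial would need \<open>k\<close> roots, so it is zero.\<close>

lemma poly_reflect_p: "poly_reflect (p k) = smult ((-1) ^ k) (p k)"
proof -
  define d where "d = poly_reflect (p k) + smult (- ((-1) ^ k)) (p k)"
  have coeff_d: "coeff d i = 0" if "i \<ge> k" for i
    using that p_degree[of k] p_coeff[of k]
    by (cases "i = k") (simp_all add: d_def coeff_poly_reflect coeff_eq_0 del: coeff_pcompose_linear)
  have orth: "pairing d g = 0" if "degree g < k" for g
  proof -
    have "pairing (poly_reflect (p k)) g = pairing (p k) (poly_reflect g)"
      using reflect[of "p k" "poly_reflect g"] by (simp add: poly_reflect_poly_reflect)
    also have "\<dots> = 0" using that by (intro p_orthogonal) (simp add: degree_pcompose)
    finally show ?thesis using p_orthogonal[OF that]
      by (simp add: d_def pairing_add_left pairing_smult_left del: smult_minus_left)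
  qed
  have "d = 0"
  proof (rule ccontr)
    assume "d \<noteq> 0"
    then have "k \<le> degree d" using degree_ge_of_orthogonal[OF _ orth, where D = "{}"] by simp
    then show False using coeff_d \<open>d \<noteq> 0\<close> by (metis leading_coeff_0_iff)
  qed
  then show ?thesis by (simp add: d_def)
qed

lemma p_root_minus: "poly (p k) (- x) = 0 \<longleftrightarrow> poly (p k) x = 0"
proof -
  have "poly (p k) (- x) = (-1) ^ k * poly (p k) x"
    using arg_cong[OF poly_reflect_p[of k], of "\<lambda>f. poly f x"] by (simp add: poly_pcompose)
  then show ?thesis by simp
qed

lemma card_p_positive_roots: "card {x \<in> {0<..}. poly (p k) x = 0} = k div 2"
proof -
  let ?R = "{x. poly (p k) x = 0}"
  let ?P = "{x \<in> {0<..}. poly (p k) x = 0}" and ?N = "{x \<in> {..<0}. poly (p k) x = 0}"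
    and ?Z = "{x \<in> {0}. poly (p k) x = 0}"
  have "k = card ?R" by (rule card_p_roots[symmetric])
  also have "?R = (?P \<union> ?N) \<union> ?Z" by auto
  also have "card \<dots> = card (?P \<union> ?N) + card ?Z"
    using finite_p_roots[of k] by (intro card_Un_disjoint) auto
  also have "card (?P \<union> ?N) = card ?P + card ?N"
    using finite_p_roots[of k] by (intro card_Un_disjoint) auto
  also have "card ?N = card ?P"
  proof -
    have "?N = uminus ` ?P"
    proof (intro set_eqI iffI)
      fix x assume "x \<in> ?N"
      then have "- x \<in> ?P" by (simp add: p_root_minus)
      then show "x \<in> uminus ` ?P" by (rule rev_image_eqI) simp
    qed (auto simp: p_root_minus)
    then show ?thesis by (simp add: card_image)
  qed
  finally have "k = 2 * card ?P + card ?Z" by simp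
  moreover have "card ?Z \<le> 1" using card_mono[of "{0}" ?Z] by auto
  ultimately show ?thesis by linarith
qed

lemma positive_zeros_p:
  "positive_zeros (p k) = image_mset complex_of_real (mset_set {x \<in> {0<..}. poly (p k) x = 0})"
  unfolding positive_zeros_def zeros_p
  using finite_p_roots[of k] by (simp add: filter_mset_image_mset conj_commute)

text \<open>A combination of \<open>p k\<close> and \<open>p (k + 2)\<close> has a parity, so that a multiple root at \<open>x > 0\<close> would be accompanied by
  one at \<open>- x\<close>. Two multiple roots are one too many when the degree exceeds \<open>k\<close> by only \<open>2\<close>.\<close>

lemma positive_zeros_interlace:
  "zeros_interlace (positive_zeros (p k)) (positive_zeros (p (k + 2)))"
proof -
  have "poly (wronskian (p k) (p (k + 2))) x \<noteq> 0" if "0 < x" for x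
  proof
    assume "poly (wronskian (p k) (p (k + 2))) x = 0"
    then obtain a b where ab: "a \<noteq> 0 \<or> b \<noteq> 0" "poly (smult a (p k) + smult b (p (k + 2))) x = 0"
        "poly (pderiv (smult a (p k) + smult b (p (k + 2)))) x = 0"
      by (rule double_root_of_wronskian_root)
    define f where "f = smult a (p k) + smult b (p (k + 2))"
    have sym: "poly_reflect f = smult ((-1) ^ k) f"
      by (simp add: f_def pcompose_add pcompose_smult poly_reflect_p smult_add_right mult.commute)
    have "poly f (- x) = (-1) ^ k * poly f x"
      using arg_cong[OF sym, of "\<lambda>f. poly f x"] by (simp add: poly_pcompose)
    moreover have "- poly (pderiv f) (- x) = (-1) ^ k * poly (pderiv f) x"
      using arg_cong[OF sym, of "\<lambda>f. poly (pderiv f) x"]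
      by (simp add: pderiv_pcompose poly_pcompose pderiv_smult pderiv_pCons)
    ultimately have "k + 2 * card {x, - x} \<le> k + 2"
      using ab by (intro combination_multiple_roots[OF _ ab(1) f_def]) (auto simp: f_def)
    then show False using that by simp
  qed
  then show ?thesis
    using zeros_interlace_of_wronskian[of "{0<..}" "p k" "p (k + 2)"]
      finite_p_roots[of k] finite_p_roots[of "k + 2"]
    by (simp add: positive_zeros_p card_p_positive_roots[simplified])
qed

end

end

section \<open>Reduction to Borel weights\<close>

lemma AE_lborel_prod:
  fixes P :: "real \<Rightarrow> bool"
  assumes "AE x in lborel. P x"
  shows "AE z in (lborel :: (real \<times> real) measure). P (fst z)"
    and "AE z in (lborel :: (real \<times> real) measure). P (snd z)"
proof -
  obtain N where N: "{x. \<not> P x} \<subseteq> N" "N \<in> null_sets lborel"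
    using assms by (auto simp: eventually_ae_filter)
  have "N \<times> UNIV \<in> null_sets (lborel \<Otimes>\<^sub>M lborel)" "UNIV \<times> N \<in> null_sets (lborel \<Otimes>\<^sub>M lborel)"
    using N(2) lborel.times_in_null_sets1[of N lborel UNIV] lborel.times_in_null_sets2[of N lborel UNIV]
    by auto
  then have null: "N \<times> UNIV \<in> null_sets lborel" "UNIV \<times> N \<in> null_sets lborel"
    unfolding lborel_prod by blast+
  show "AE z in (lborel :: (real \<times> real) measure). P (fst z)"
    by (rule AE_I'[OF null(1)]) (use N(1) in auto)
  show "AE z in (lborel :: (real \<times> real) measure). P (snd z)"
    by (rule AE_I'[OF null(2)]) (use N(1) in auto)
qed

lemma lborel_reflect: "distr lborel borel uminus = (lborel :: 'a::euclidean_space measure)"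
  by (subst lborel_affine[of "-1" 0]) (auto simp: density_1 one_ennreal_def[symmetric])

text \<open>Lebesgue measurable \<open>V\<close> and \<open>W\<close> agree almost everywhere with Borel functions. Changing them on null sets of
  the line changes the weight on a null set of the plane, and leaves an integrand to which Fubini's theorem for
  products of Borel measures applies.\<close>

lemma tm_weight_ae_coupled:
  assumes V: "V \<in> borel_measurable lebesgue" and W: "W \<in> borel_measurable lebesgue"
    and "\<tau> \<noteq> 0" "n \<ge> 1" and mom: "moments_converge n \<tau> V W"
  obtains u v where "exp_coupled_weights u v (real n * \<tau>)"
    "AE z in lborel. tm_weight n \<tau> V W (fst z) (snd z) =
       u (fst z) * v (snd z) * exp (real n * \<tau> * fst z * snd z)"
proof -
  obtain V' where V': "V' \<in> borel_measurable borel" "AE x in lborel. V x = V' x"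
    using completion_ex_borel_measurable_real[OF V] by auto
  obtain W' where W': "W' \<in> borel_measurable borel" "AE x in lborel. W x = W' x"
    using completion_ex_borel_measurable_real[OF W] by auto
  note [measurable] = V'(1) W'(1)
  define u where "u x = exp (- (real n * V' x))" for x
  define v where "v y = exp (- (real n * W' y))" for y
  have [measurable]: "u \<in> borel_measurable borel" "v \<in> borel_measurable borel"
    unfolding u_def v_def by measurable
  have ae: "AE z in lborel. tm_weight n \<tau> V W (fst z) (snd z) =
       u (fst z) * v (snd z) * exp (real n * \<tau> * fst z * snd z)"
    using AE_lborel_prod(1)[OF V'(2)] AE_lborel_prod(2)[OF W'(2)]
    by eventually_elim (simp add: tm_weight_def u_def v_def algebra_simps flip: exp_add)
  have "exp_coupled_weights u v (real n * \<tau>)"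
  proof
    fix k j
    let ?F = "\<lambda>(x, y). x ^ k * y ^ j * (u x * v y * exp (real n * \<tau> * x * y))"
    have meas: "?F \<in> borel_measurable lborel" by (simp add: case_prod_unfold flip: lborel_prod)
    have "integrable lebesgue ?F"
    proof (rule integrable_cong_AE_imp)
      show "integrable lebesgue (\<lambda>(x, y). x ^ k * y ^ j * tm_weight n \<tau> V W x y)"
        using mom by (simp add: moments_converge_def)
      show "?F \<in> borel_measurable lebesgue" using meas by (rule measurable_completion)
      show "AE z in lebesgue. (case z of (x, y) \<Rightarrow> x ^ k * y ^ j * tm_weight n \<tau> V W x y) = ?F z"
        using AE_completion[OF ae] by eventually_elim (simp add: case_prod_unfold)
    qed
    then show "integrable (lborel \<Otimes>\<^sub>M lborel) ?F"
      using integrable_completion[OF meas] by (simp add: lborel_prod)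
  qed (use assms in \<open>auto simp: u_def v_def\<close>)
  then show thesis using that ae by blast
qed

context exp_coupled_weights
begin

lemma pairing_lborel:
  "pairing f g = (LINT z|lborel. poly f (fst z) * poly g (snd z) *
     (u (fst z) * v (snd z) * exp (c * fst z * snd z)))"
  unfolding pairing_def by (simp add: case_prod_unfold lborel_prod)

lemma pairing_eq_lebesgue_integral:
  assumes meas: "(\<lambda>(x, y). w x y) \<in> borel_measurable lebesgue"
    and ae: "AE z in lborel. w (fst z) (snd z) = u (fst z) * v (snd z) * exp (c * fst z * snd z)"
  shows "(LINT (x, y)|lebesgue. poly f x * poly g y * w x y) = pairing f g"
proof -
  let ?F = "\<lambda>z. poly f (fst z) * poly g (snd z) * (u (fst z) * v (snd z) * exp (c * fst z * snd z))"
  have F: "?F \<in> borel_measurable lborel" by (simp flip: lborel_prod)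
  have fg: "(\<lambda>z. poly f (fst z) * poly g (snd z)) \<in> borel_measurable lebesgue"
    by (rule measurable_completion) (simp flip: lborel_prod)
  have "(LINT (x, y)|lebesgue. poly f x * poly g y * w x y) = (LINT z|lebesgue. ?F z)"
  proof (rule integral_cong_AE)
    show "(\<lambda>(x, y). poly f x * poly g y * w x y) \<in> borel_measurable lebesgue"
      using borel_measurable_times[OF fg meas] by (simp add: case_prod_unfold)
    show "?F \<in> borel_measurable lebesgue" using F by (rule measurable_completion)
    show "AE z in lebesgue. (case z of (x, y) \<Rightarrow> poly f x * poly g y * w x y) = ?F z"
      using AE_completion[OF ae] by eventually_elim (simp add: case_prod_unfold)
  qed
  also have "\<dots> = pairing f g" using integral_completion[OF F] by (simp add: pairing_lborel)
  finally show ?thesis .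
qed

text \<open>The symmetry is stated for the original weight \<open>w\<close>, because its Borel version inherits it only almost
  everywhere.\<close>

lemma pairing_reflect:
  assumes even: "\<And>x y. w (- x) (- y) = w x y"
    and ae: "AE z in lborel. w (fst z) (snd z) = u (fst z) * v (snd z) * exp (c * fst z * snd z)"
  shows "pairing (poly_reflect f) (poly_reflect g) = pairing f g"
proof -
  let ?K = "\<lambda>z. u (fst z) * v (snd z) * exp (c * fst z * snd z)"
  let ?F = "\<lambda>z. poly f (fst z) * poly g (snd z) * ?K z"
  have F [measurable]: "?F \<in> borel_measurable borel" by (simp flip: borel_prod)
  have reflected: "AE z in lborel. w (fst (- z)) (snd (- z)) = ?K (- z)"
  proof -
    have "AE z in distr lborel borel uminus. w (fst z) (snd z) = ?K z"
      unfolding lborel_reflect by (rule ae)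
    then show ?thesis by (rule AE_distrD[rotated]) simp
  qed
  have K: "AE z in lborel. ?K (- z) = ?K z"
    using ae reflected by eventually_elim (simp add: even)
  have "pairing f g = (LINT z|distr lborel borel uminus. ?F z)"
    by (simp add: lborel_reflect pairing_lborel)
  also have "\<dots> = (LINT z|lborel. ?F (- z))"
    by (rule integral_distr) simp_all
  also have "\<dots> = (LINT z|lborel. poly f (- fst z) * poly g (- snd z) * ?K z)"
  proof (rule integral_cong_AE)
    show "AE z in lborel. ?F (- z) = poly f (- fst z) * poly g (- snd z) * ?K z"
      using K by eventually_elim simp
  qed (simp_all flip: lborel_prod)
  also have "\<dots> = pairing (poly_reflect f) (poly_reflect g)"
    by (simp add: pairing_lborel poly_pcompose)
  finally show ?thesis by simp
qed

end

section \<open>Interlacing of the zeros\<close>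

theorem theorem2p1:
  fixes \<tau> :: real and n :: nat and V W :: "real \<Rightarrow> real" and p q :: "nat \<Rightarrow> real poly"
  assumes "\<tau> \<noteq> 0" and "n \<ge> 1"
    and "V \<in> borel_measurable lebesgue" and "W \<in> borel_measurable lebesgue"
    and "moments_converge n \<tau> V W"
    and "monic_biorthogonal n \<tau> V W p q"
  shows "\<forall>k\<ge>1.
      (zeros_interlace (zeros (p k)) (zeros (p (k + 1))) \<and>
       zeros_interlace (zeros (q k)) (zeros (q (k + 1)))) \<and>
      ((\<forall>x. V (- x) = V x) \<and> (\<forall>y. W (- y) = W y) \<longrightarrow>
       zeros_interlace (positive_zeros (p k)) (positive_zeros (p (k + 2))) \<and>
       zeros_interlace (positive_zeros (q k)) (positive_zeros (q (k + 2))))"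
proof -
  obtain u v where coupled: "exp_coupled_weights u v (real n * \<tau>)"
    and ae: "AE z in lborel. tm_weight n \<tau> V W (fst z) (snd z) =
       u (fst z) * v (snd z) * exp (real n * \<tau> * fst z * snd z)"
    by (rule tm_weight_ae_coupled[OF assms(3,4,1,2,5)])
  interpret exp_coupled_weights u v "real n * \<tau>" by (rule coupled)
  have "integrable lebesgue (\<lambda>(x, y). x ^ 0 * y ^ 0 * tm_weight n \<tau> V W x y)"
    using assms(5) unfolding moments_converge_def by blast
  then have meas: "(\<lambda>(x, y). tm_weight n \<tau> V W x y) \<in> borel_measurable lebesgue"
    by (auto dest: borel_measurable_integrable)
  interpret P: biorthogonal_polys u v "real n * \<tau>" p q
  proof
    fix k j :: nat assume "k \<noteq> j"
    then show "pairing (p k) (q j) = 0"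
      using assms(6) unfolding monic_biorthogonal_def
      by (simp add: pairing_eq_lebesgue_integral[OF meas ae])
  qed (use assms(6)[unfolded monic_biorthogonal_def] in blast)+
  interpret Q: biorthogonal_polys v u "real n * \<tau>" q p by (rule P.biorthogonal_polys_swap)
  have "zeros_interlace (positive_zeros (p k)) (positive_zeros (p (k + 2))) \<and>
      zeros_interlace (positive_zeros (q k)) (positive_zeros (q (k + 2)))"
    if "\<forall>x. V (- x) = V x" "\<forall>y. W (- y) = W y" for k
  proof -
    have "tm_weight n \<tau> V W (- x) (- y) = tm_weight n \<tau> V W x y" for x y
      using that by (simp add: tm_weight_def)
    note reflect = pairing_reflect[OF this ae]
    have "Q.pairing (poly_reflect f) (poly_reflect g) = Q.pairing f g" for f g
      using reflect[of g f] by (simp add: pairing_swap)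
    then show ?thesis using P.positive_zeros_interlace[OF reflect] Q.positive_zeros_interlace by blast
  qed
  then show ?thesis using P.consecutive_zeros_interlace Q.consecutive_zeros_interlace by blast
qed

end
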